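(* If $W_n$ is a wheel graph with $n\geq 5$, then $W_n\in\mathcal{A}(3)$, i.e., every subgraph $H$ of $W_n$ with $\Delta(H)\leq 3$ has a proper $3$-edge-coloring.
   Context: The wheel graph $W_n$ has vertex set $\{v_0,v_1,\dots,v_n\}$ and edge set $\{v_1v_2,v_2v_3,\dots,v_{n-1}v_n,v_nv_1\}\cup\{v_0v_1,\dots,v_0v_n\}$. For an integer $q\geq 2$, $\mathcal{A}(q)$ is the set of graphs $G$ such that every subgraph $H$ of $G$ with maximum degree $\Delta(H)\leq q$ has a proper $q$-edge-coloring (adjacent edges receive distinct colors). *)

theory Defs
  imports Main
begin

record 'a ugraph =
  vertices :: "'a set"
  edges :: "'a set set"

definition simple_graph :: "'a ugraph \<Rightarrow> bool" where
  "simple_graph G \<longleftrightarrow> finite (vertices G) \<and>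
     edges G \<subseteq> {{u, v} | u v. u \<in> vertices G \<and> v \<in> vertices G \<and> u \<noteq> v}"

definition subgraph_of :: "'a ugraph \<Rightarrow> 'a ugraph \<Rightarrow> bool" where
  "subgraph_of H G \<longleftrightarrow> simple_graph H \<and> vertices H \<subseteq> vertices G \<and> edges H \<subseteq> edges G"

definition degree :: "'a ugraph \<Rightarrow> 'a \<Rightarrow> nat" where
  "degree G v = card {e \<in> edges G. v \<in> e}"

(* Inserting 0 only matters for the graph without vertices. *)
definition max_degree :: "'a ugraph \<Rightarrow> nat" where
  "max_degree G = Max (insert 0 (degree G ` vertices G))"

definition proper_edge_coloring :: "'a ugraph \<Rightarrow> nat \<Rightarrow> ('a set \<Rightarrow> nat) \<Rightarrow> bool" where
  "proper_edge_coloring G q c \<longleftrightarrow>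
     (\<forall>e \<in> edges G. c e < q) \<and>
     (\<forall>e \<in> edges G. \<forall>f \<in> edges G. e \<noteq> f \<and> e \<inter> f \<noteq> {} \<longrightarrow> c e \<noteq> c f)"

definition edge_colorable :: "'a ugraph \<Rightarrow> nat \<Rightarrow> bool" where
  "edge_colorable G q \<longleftrightarrow> (\<exists>c. proper_edge_coloring G q c)"

definition class_A :: "nat \<Rightarrow> 'a ugraph set" where
  "class_A q = {G. simple_graph G \<and>
     (\<forall>H. subgraph_of H G \<and> max_degree H \<le> q \<longrightarrow> edge_colorable H q)}"

(* The wheel with hub v 0 and rim v 1, ..., v n; meaningful only when v is
   injective on {0..n} and n is at least 3. *)
definition wheel :: "(nat \<Rightarrow> 'a) \<Rightarrow> nat \<Rightarrow> 'a ugraph" where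
  "wheel v n = \<lparr> vertices = v ` {0..n},
     edges = {{v i, v (i + 1)} | i. 1 \<le> i \<and> i < n} \<union> {{v n, v 1}}
             \<union> {{v 0, v i} | i. 1 \<le> i \<and> i \<le> n} \<rparr>"

end

theory Submission
  imports Defs
begin

text \<open>
  A subgraph with maximum degree at most 3 uses at most three spokes, and it suffices to colour
  the whole rim together with exactly three spokes, which get the colours 0, 1, 2. The spokes cut
  the rim into three segments. A path with \<open>m\<close> edges can be properly 3-coloured with prescribed
  first and last colours \<open>x\<close> and \<open>y\<close> unless \<open>m = 1\<close> and \<open>x \<noteq> y\<close>, or \<open>m = 2\<close> and \<open>x = y\<close>.
  At each of the three spoke ends there are two ways to distribute the two remaining colours over
  the two rim edges; call the vertex aligned if each of these rim edges gets the colour that is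
  also available at the other end of its segment. Then a segment of length 1 needs both ends
  aligned, and a segment of length 2 needs an end that is not. Aligning exactly the ends of the
  segments of length 1 fails only for the lengths 1, 1, 2, which is excluded by \<open>n \<ge> 5\<close>.
\<close>

section \<open>Colourings of paths and of the rim\<close>

definition path_coloring :: "(nat \<Rightarrow> nat) \<Rightarrow> nat \<Rightarrow> nat \<Rightarrow> nat \<Rightarrow> bool" where
  "path_coloring f m x y \<longleftrightarrow> f 0 = x \<and> f (m - 1) = y \<and> (\<forall>i<m. f i < 3) \<and>
     (\<forall>i. Suc i < m \<longrightarrow> f i \<noteq> f (Suc i))"

text \<open>Induction on the length: for at least three edges, an edge coloured \<open>x\<close> is
  put in front of a shorter path.\<close>

lemma exists_path_coloring:
  assumes "m \<ge> 1" "x < 3" "y < 3" "m = 1 \<Longrightarrow> x = y" "m = 2 \<Longrightarrow> x \<noteq> y"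
  shows "\<exists>f. path_coloring f m x y"
  using assms
proof (induction m arbitrary: x)
  case 0
  then show ?case by simp
next
  case (Suc m)
  consider "m = 0" | "m = 1" | "m \<ge> 2" by linarith
  then show ?case
  proof cases
    case 1
    then show ?thesis
      using Suc.prems by (intro exI[of _ "\<lambda>_. x"]) (simp add: path_coloring_def)
  next
    case 2
    then show ?thesis
      using Suc.prems by (intro exI[of _ "\<lambda>i. if i = 0 then x else y"]) (simp add: path_coloring_def)
  next
    case 3
    \<comment> \<open>Avoiding \<open>y\<close> as well as \<open>x\<close> meets the condition of
      the induction hypothesis when the remaining path has two edges.\<close>
    obtain z :: nat where z: "z < 3" "z \<noteq> x" "z \<noteq> y"
    proof -
      have "\<not> {0, 1, 2} \<subseteq> {x, y}" by auto
      then show ?thesis using that[of 0] that[of 1] that[of 2] by auto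
    qed
    obtain f where f: "path_coloring f m z y"
      using Suc.IH[of z] 3 z Suc.prems by auto
    have "path_coloring (case_nat x f) (Suc m) x y"
      using f 3 z Suc.prems by (auto simp: path_coloring_def split: nat.split)
    then show ?thesis by blast
  qed
qed

text \<open>Here \<open>r i\<close> is the colour of the rim edge from vertex \<open>i\<close> to
  its cyclic successor, and the spokes at \<open>a\<close>, \<open>b\<close>, \<open>c\<close> carry
  0, 1, 2. Only \<open>a\<close> can be vertex 1, whose preceding rim edge is
  \<open>n\<close>.\<close>

lemma exists_rim_coloring:
  fixes n a b c :: nat
  assumes "1 \<le> a" "a < b" "b < c" "c \<le> n" "5 \<le> n"
  obtains r :: "nat \<Rightarrow> nat" where
    "\<And>i. 1 \<le> i \<Longrightarrow> i \<le> n \<Longrightarrow> r i < 3"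
    "\<And>i. 1 \<le> i \<Longrightarrow> i < n \<Longrightarrow> r i \<noteq> r (Suc i)"
    "r n \<noteq> r 1"
    "r (if a = 1 then n else a - 1) \<noteq> 0" "r a \<noteq> 0"
    "r (b - 1) \<noteq> 1" "r b \<noteq> 1"
    "r (c - 1) \<noteq> 2" "r c \<noteq> 2"
proof -
  \<comment> \<open>The third segment runs from \<open>c\<close> past \<open>n\<close> to
    \<open>a\<close>.\<close>
  define g1 g2 g3 where "g1 = b - a" and "g2 = c - b" and "g3 = n - c + a"
  note g = g1_def g2_def g3_def
  \<comment> \<open>These say which spoke ends are aligned. The colours available at both ends of
    the three segments are 2, 0 and 1 respectively.\<close>
  define A B C where "A \<longleftrightarrow> g1 = 1 \<or> g3 = 1" and "B \<longleftrightarrow> g1 = 1 \<or> g2 = 1"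
    and "C \<longleftrightarrow> g2 = 1 \<or> g3 = 1"
  note ABC = A_def B_def C_def
  have ge: "g1 \<ge> 1" "g2 \<ge> 1" "g3 \<ge> 1" and sum: "g1 + g2 + g3 \<ge> 5"
    using assms by (auto simp: g)
  \<comment> \<open>If \<open>g1 = 1\<close>, both end colours are 2. They agree only under
    \<open>A\<close> and \<open>B\<close>; with \<open>g1 = 2\<close> this would force
    \<open>g2 = g3 = 1\<close>, a total of 4.\<close>
  obtain f1 where f1: "path_coloring f1 g1 (if A then 2 else 1) (if B then 2 else 0)"
  proof -
    have "\<exists>f. path_coloring f g1 (if A then 2 else 1) (if B then 2 else 0)"
      by (rule exists_path_coloring) (use ge sum in \<open>auto simp: ABC\<close>)
    then show ?thesis using that by blast
  qed
  obtain f2 where f2: "path_coloring f2 g2 (if B then 0 else 2) (if C then 0 else 1)"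
  proof -
    have "\<exists>f. path_coloring f g2 (if B then 0 else 2) (if C then 0 else 1)"
      by (rule exists_path_coloring) (use ge sum in \<open>auto simp: ABC\<close>)
    then show ?thesis using that by blast
  qed
  obtain f3 where f3: "path_coloring f3 g3 (if C then 1 else 0) (if A then 1 else 2)"
  proof -
    have "\<exists>f. path_coloring f g3 (if C then 1 else 0) (if A then 1 else 2)"
      by (rule exists_path_coloring) (use ge sum in \<open>auto simp: ABC\<close>)
    then show ?thesis using that by blast
  qed
  \<comment> \<open>In the third segment edge \<open>c\<close> has position 0 and edge
    \<open>n\<close> position \<open>n - c\<close>, so edge 1, if it lies there, has position
    \<open>1 + n - c\<close>.\<close>
  define r where "r i = (if i < a then f3 (i + n - c) else if i < b then f1 (i - a)
    else if i < c then f2 (i - b) else f3 (i - c))" for i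
  have lt: "\<And>i. i < g1 \<Longrightarrow> f1 i < 3" "\<And>i. i < g2 \<Longrightarrow> f2 i < 3" "\<And>i. i < g3 \<Longrightarrow> f3 i < 3"
    using f1 f2 f3 by (auto simp: path_coloring_def)
  have step: "\<And>i. Suc i < g1 \<Longrightarrow> f1 i \<noteq> f1 (Suc i)" "\<And>i. Suc i < g2 \<Longrightarrow> f2 i \<noteq> f2 (Suc i)"
    "\<And>i. Suc i < g3 \<Longrightarrow> f3 i \<noteq> f3 (Suc i)"
    using f1 f2 f3 by (auto simp: path_coloring_def)
  have ra: "r a = (if A then 2 else 1)"
    using f1 assms by (simp add: r_def path_coloring_def)
  have rb: "r b = (if B then 0 else 2)"
    using f2 assms by (simp add: r_def path_coloring_def)
  have rc: "r c = (if C then 1 else 0)"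
    using f3 assms by (simp add: r_def path_coloring_def)
  have rb': "r (b - 1) = (if B then 2 else 0)"
  proof -
    have "\<not> b - 1 < a" using assms by linarith
    then show ?thesis using f1 assms by (simp add: r_def path_coloring_def g)
  qed
  have rc': "r (c - 1) = (if C then 0 else 1)"
  proof -
    have "\<not> c - 1 < b" using assms by linarith
    then show ?thesis using f2 assms by (simp add: r_def path_coloring_def g)
  qed
  have ra': "r (if a = 1 then n else a - 1) = (if A then 1 else 2)"
  proof -
    have "r (if a = 1 then n else a - 1) = f3 (g3 - 1)"
      using assms by (auto simp: r_def g intro!: arg_cong[of _ _ f3])
    then show ?thesis using f3 by (simp add: path_coloring_def)
  qed
  show ?thesis
  proof (rule that)
    show "r i < 3" if "1 \<le> i" "i \<le> n" for i
      using that assms unfolding r_def by (auto intro!: lt simp: g)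
    show "r i \<noteq> r (Suc i)" if i: "1 \<le> i" "i < n" for i
    proof -
      \<comment> \<open>Consecutive rim edges lie in one segment or meet at a spoke end.\<close>
      consider "Suc i < a" | "Suc i = a" | "a \<le> i" "Suc i < b" | "Suc i = b"
        | "b \<le> i" "Suc i < c" | "Suc i = c" | "c \<le> i" by linarith
      then show ?thesis
      proof cases
        case 1
        then show ?thesis using step(3)[of "i + n - c"] assms
          by (simp add: r_def g Suc_diff_le)
      next
        case 2
        then show ?thesis using ra ra' i by (auto split: if_splits)
      next
        case 3
        then show ?thesis using step(1)[of "i - a"] by (simp add: r_def g Suc_diff_le)
      next
        case 4
        then show ?thesis using rb rb' by auto
      next
        case 5
        then show ?thesis using step(2)[of "i - b"] assms by (simp add: r_def g Suc_diff_le)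
      next
        case 6
        then show ?thesis using rc rc' by auto
      next
        case 7
        then show ?thesis using step(3)[of "i - c"] i assms by (simp add: r_def g Suc_diff_le)
      qed
    qed
    show "r n \<noteq> r 1"
    proof (cases "a = 1")
      case True
      then show ?thesis using ra ra' by auto
    next
      case False
      then show ?thesis using step(3)[of "n - c"] assms by (simp add: r_def g Suc_diff_le)
    qed
  qed (use ra ra' rb rb' rc rc' in auto)
qed

section \<open>Simplicity of the wheel and hub degrees of its subgraphs\<close>

lemma simple_graph_wheel:
  assumes "inj_on v {0..n}" and "n \<ge> 2"
  shows "simple_graph (wheel v n)"
proof -
  have "\<exists>a b. {v i, v j} = {a, b} \<and> a \<in> v ` {0..n} \<and> b \<in> v ` {0..n} \<and> a \<noteq> b"
    if "i \<le> n" "j \<le> n" "i \<noteq> j" for i j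
    using that assms(1) by (intro exI[of _ "v i"] exI[of _ "v j"]) (auto simp: inj_on_def)
  then show ?thesis
    using assms(2) by (auto simp: simple_graph_def wheel_def)
qed

lemma degree_le_max_degree:
  assumes "simple_graph G" "x \<in> vertices G"
  shows "degree G x \<le> max_degree G"
  using assms by (auto simp: max_degree_def simple_graph_def intro!: Max_ge)

text \<open>Injectivity of \<open>v\<close> makes distinct indices give distinct spokes. A hub
  outside \<open>H\<close> is not covered by \<open>max_degree\<close>, but then \<open>H\<close>
  has no spokes.\<close>

lemma hub_degree_subgraph_of_wheel:
  assumes inj: "inj_on v {0..n}" and H: "subgraph_of H (wheel v n)"
  shows "card {i \<in> {1..n}. {v 0, v i} \<in> edges H} \<le> max_degree H"
proof (cases "v 0 \<in> vertices H")
  case True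
  have sg: "simple_graph H" using H by (simp add: subgraph_of_def)
  have "edges H \<subseteq> Pow (vertices H)" using sg by (auto simp: simple_graph_def)
  then have "finite (edges H)"
    using sg by (meson finite_Pow_iff finite_subset simple_graph_def)
  moreover have "inj_on (\<lambda>i. {v 0, v i}) {i \<in> {1..n}. {v 0, v i} \<in> edges H}"
    using inj by (auto simp: inj_on_def doubleton_eq_iff)
  ultimately have "card {i \<in> {1..n}. {v 0, v i} \<in> edges H} \<le> degree H (v 0)"
    unfolding degree_def by (intro card_inj_on_le) auto
  also have "\<dots> \<le> max_degree H"
    using sg True by (rule degree_le_max_degree)
  finally show ?thesis .
next
  case False
  then have "{i \<in> {1..n}. {v 0, v i} \<in> edges H} = {}"
    using H by (auto simp: subgraph_of_def simple_graph_def doubleton_eq_iff dest!: subsetD)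
  then show ?thesis by (simp only: card.empty)
qed

lemma card_3_sorted:
  fixes T :: "'a :: linorder set"
  assumes "card T = 3"
  obtains a b c where "T = {a, b, c}" "a < b" "b < c"
proof -
  obtain x y z where xyz: "T = {x, y, z}" "x \<noteq> y" "y \<noteq> z" "x \<noteq> z"
    using assms by (auto simp: card_3_iff)
  then consider "x < y" "y < z" | "x < z" "z < y" | "y < x" "x < z" | "y < z" "z < x"
    | "z < x" "x < y" | "z < y" "y < x"
    by (metis linorder_neqE)
  then show ?thesis
    by cases (use xyz(1) that in \<open>(blast | metis insert_commute)+\<close>)
qed

section \<open>Colouring a subgraph of the wheel\<close>

theorem proposition2p8:
  fixes v :: "nat \<Rightarrow> 'a" and n :: nat
  assumes "inj_on v {0..n}" and "n \<ge> 5"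
  shows "wheel v n \<in> class_A 3"
proof -
  have v_eq: "v i = v j \<longleftrightarrow> i = j" if "i \<le> n" "j \<le> n" for i j
    using that assms(1) by (auto simp: inj_on_def)
  define nxt where "nxt i = (if i = n then 1 else Suc i)" for i
  have nxt: "1 \<le> nxt i" "nxt i \<le> n" "nxt i \<noteq> i" if "1 \<le> i" "i \<le> n" for i
    using that assms(2) by (auto simp: nxt_def)
  have nxt_inj: "nxt i = nxt j \<longleftrightarrow> i = j" if "1 \<le> i" "1 \<le> j" for i j
    using that by (auto simp: nxt_def)
  \<comment> \<open>This makes a rim edge determine its index:
    \<open>{v i, v (nxt i)} = {v j, v (nxt j)}\<close> with \<open>i \<noteq> j\<close> would give
    \<open>nxt (nxt i) = i\<close>.\<close>
  have nxt_nxt: "nxt (nxt i) \<noteq> i" if "1 \<le> i" "i \<le> n" for i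
    using that assms(2) by (auto simp: nxt_def split: if_splits)
  have wheel_edge: "(\<exists>i. 1 \<le> i \<and> i \<le> n \<and> e = {v i, v (nxt i)}) \<or>
      (\<exists>i. 1 \<le> i \<and> i \<le> n \<and> e = {v 0, v i})" if "e \<in> edges (wheel v n)" for e
  proof -
    from that consider i where "1 \<le> i" "i < n" "e = {v i, v (Suc i)}" | "e = {v n, v 1}"
      | i where "1 \<le> i" "i \<le> n" "e = {v 0, v i}"
      by (auto simp: wheel_def)
    then show ?thesis
    proof cases
      case 1
      then show ?thesis by (intro disjI1 exI[of _ i]) (auto simp: nxt_def)
    next
      case 2
      then show ?thesis using assms(2) by (intro disjI1 exI[of _ n]) (auto simp: nxt_def)
    qed blast
  qed
  have "edge_colorable H 3" if H: "subgraph_of H (wheel v n)" and deg: "max_degree H \<le> 3" for H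
  proof -
    define S where "S = {i \<in> {1..n}. {v 0, v i} \<in> edges H}"
    have "card S \<le> 3"
      using hub_degree_subgraph_of_wheel[OF assms(1) H] deg by (simp add: S_def)
    moreover have "S \<subseteq> {1..n}" by (auto simp: S_def)
    \<comment> \<open>Padding to exactly three indices may add spokes outside \<open>H\<close>,
      which does no harm.\<close>
    ultimately obtain T where T: "S \<subseteq> T" "T \<subseteq> {1..n}" "card T = 3"
      using exists_subset_between[of S 3 "{1..n}"] assms(2) by auto
    obtain a b c where abc: "T = {a, b, c}" "a < b" "b < c"
      using T(3) by (rule card_3_sorted)
    have bounds: "1 \<le> a" "c \<le> n" using T(2) abc by auto
    obtain r :: "nat \<Rightarrow> nat" where
      r_lt: "\<And>i. 1 \<le> i \<Longrightarrow> i \<le> n \<Longrightarrow> r i < 3" and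
      r_Suc: "\<And>i. 1 \<le> i \<Longrightarrow> i < n \<Longrightarrow> r i \<noteq> r (Suc i)" and
      r_wrap: "r n \<noteq> r 1" and
      r_ends: "r (if a = 1 then n else a - 1) \<noteq> 0" "r a \<noteq> 0" "r (b - 1) \<noteq> 1" "r b \<noteq> 1"
        "r (c - 1) \<noteq> 2" "r c \<noteq> 2"
      using exists_rim_coloring[OF bounds(1) abc(2,3) bounds(2) assms(2)] by blast
    have r_nxt: "r i \<noteq> r (nxt i)" if "1 \<le> i" "i \<le> n" for i
      using that r_Suc r_wrap by (auto simp: nxt_def)
    define s :: "nat \<Rightarrow> nat" where "s i = (if i = a then 0 else if i = b then 1 else 2)" for i
    have s_rim: "r i \<noteq> s i" if "i \<in> T" for i
      using that r_ends abc by (auto simp: s_def)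
    have s_rim': "r i \<noteq> s (nxt i)" if "nxt i \<in> T" "1 \<le> i" "i \<le> n" for i
      using that r_ends abc bounds by (auto simp: s_def nxt_def split: if_splits)
    have s_inj: "s i \<noteq> s j" if "i \<in> T" "j \<in> T" "i \<noteq> j" for i j
      using that abc by (auto simp: s_def)
    \<comment> \<open>Edges are bare sets, so the index is recovered from the edge; containing the
      hub separates spokes from rim edges.\<close>
    define col where "col e = (if v 0 \<in> e then s (THE i. 1 \<le> i \<and> i \<le> n \<and> v i \<in> e)
      else r (THE i. 1 \<le> i \<and> i \<le> n \<and> e = {v i, v (nxt i)}))" for e
    have col_spoke: "col {v 0, v i} = s i" if "1 \<le> i" "i \<le> n" for i
    proof -
      have "(THE j. 1 \<le> j \<and> j \<le> n \<and> v j \<in> {v 0, v i}) = i"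
        using that by (intro the_equality) (auto simp: v_eq)
      then show ?thesis by (simp add: col_def)
    qed
    have col_rim: "col {v i, v (nxt i)} = r i" if i: "1 \<le> i" "i \<le> n" for i
    proof -
      have "(THE j. 1 \<le> j \<and> j \<le> n \<and> {v i, v (nxt i)} = {v j, v (nxt j)}) = i"
        using i nxt nxt_nxt by (intro the_equality) (auto simp: v_eq doubleton_eq_iff)
      moreover have "v 0 \<notin> {v i, v (nxt i)}"
        using i nxt[OF i] by (auto simp: v_eq)
      ultimately show ?thesis by (simp add: col_def)
    qed
    have edge_cases: "(\<exists>i. 1 \<le> i \<and> i \<le> n \<and> e = {v i, v (nxt i)}) \<or>
        (\<exists>i \<in> T. 1 \<le> i \<and> i \<le> n \<and> e = {v 0, v i})" if "e \<in> edges H" for e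
    proof -
      have "e \<in> edges (wheel v n)" using that H by (auto simp: subgraph_of_def)
      from wheel_edge[OF this] show ?thesis
        using that T(1) by (auto simp: S_def)
    qed
    \<comment> \<open>A rim edge avoids the hub, so it can meet a spoke only at the outer end of
      that spoke.\<close>
    have rim_spoke: "col e \<noteq> col f"
      if "1 \<le> i" "i \<le> n" "e = {v i, v (nxt i)}" "j \<in> T" "1 \<le> j" "j \<le> n" "f = {v 0, v j}"
        "e \<inter> f \<noteq> {}" for e f i j
    proof -
      have "i = j \<or> nxt i = j"
        using that nxt[OF that(1,2)] by (auto simp: v_eq)
      then show ?thesis
        using that s_rim s_rim' by (auto simp: col_rim col_spoke)
    qed
    have "proper_edge_coloring H 3 col"
      unfolding proper_edge_coloring_def
    proof (intro conjI ballI impI)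
      fix e assume "e \<in> edges H"
      from edge_cases[OF this] show "col e < 3"
        by (auto simp: col_rim col_spoke r_lt s_def)
    next
      fix e f assume e: "e \<in> edges H" and f: "f \<in> edges H" and ef: "e \<noteq> f \<and> e \<inter> f \<noteq> {}"
      from edge_cases[OF e] edge_cases[OF f] consider
        (rr) i j where "1 \<le> i" "i \<le> n" "e = {v i, v (nxt i)}" "1 \<le> j" "j \<le> n" "f = {v j, v (nxt j)}"
        | (rs) i j where "1 \<le> i" "i \<le> n" "e = {v i, v (nxt i)}" "j \<in> T" "1 \<le> j" "j \<le> n" "f = {v 0, v j}"
        | (sr) i j where "1 \<le> i" "i \<le> n" "f = {v i, v (nxt i)}" "j \<in> T" "1 \<le> j" "j \<le> n" "e = {v 0, v j}"
        | (ss) i j where "i \<in> T" "1 \<le> i" "i \<le> n" "e = {v 0, v i}" "j \<in> T" "1 \<le> j" "j \<le> n" "f = {v 0, v j}"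
        by metis
      then show "col e \<noteq> col f"
      proof cases
        case rr
        then have "i \<noteq> j" using ef by auto
        \<comment> \<open>Since \<open>nxt\<close> is injective, distinct rim edges that meet are
          cyclically consecutive.\<close>
        then have "nxt i = j \<or> nxt j = i"
          using rr ef nxt[OF rr(1,2)] nxt[OF rr(4,5)] nxt_inj[OF rr(1,4)] by (auto simp: v_eq)
        then show ?thesis
          using rr r_nxt[OF rr(1,2)] r_nxt[OF rr(4,5)] by (auto simp: col_rim)
      next
        case rs
        then show ?thesis using rim_spoke ef by blast
      next
        case sr
        then show ?thesis using rim_spoke[of i f j e] ef by (metis inf_commute)
      next
        case ss
        then have "i \<noteq> j" using ef by auto
        then show ?thesis using ss s_inj by (simp add: col_spoke)
      qed
    qed
    then show ?thesis by (auto simp: edge_colorable_def)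
  qed
  moreover have "simple_graph (wheel v n)"
    using assms by (intro simple_graph_wheel) auto
  ultimately show ?thesis by (auto simp: class_A_def)
qed

end
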